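(* If $G=(V\cup E,\varepsilon)$ is a cycle of length $2n$, then $I_G(x)=1+x+x^2+\cdots+x^{n-1}$ and $X_G(y)=1+(n-1)y$.
   Context: $G=(V\cup E,\varepsilon)$ denotes a finite simple bipartite graph with non-empty colour classes $V$ and $E$ and edge set $\varepsilon$ (so here $n\ge 2$); the elements of $E$ are called hyperedges. For connected $G$, a hypertree of $G$ is a function $f:E\to\{0,1,2,\dots\}$ for which there is a spanning tree $\tau$ of $G$ with $d_\tau(e)=f(e)+1$ for every $e\in E$. For distinct $e,e'\in E$, we say that $e$ can transfer valence to $e'$ with respect to a hypertree $f$ if the function obtained from $f$ by decreasing $f(e)$ by 1 and increasing $f(e')$ by 1 is also a hypertree. Fix a total order on $E$. A hyperedge $e$ is internally inactive with respect to $f$ if there is $e'<e$ such that $e$ can transfer valence to $e'$ with respect to $f$, and externally inactive with respect to $f$ if there is $e'<e$ such that $e'$ can transfer valence to $e$ with respect to $f$. Let $\overline{\iota}(f)$ and $\overline{\epsilon}(f)$ be the numbers of internally, respectively externally, inactive hyperedges. The interior and exterior polynomials are $I_G(x)=\sum_f x^{\overline{\iota}(f)}$ and $X_G(y)=\sum_f y^{\overline{\epsilon}(f)}$, the sums being over all hypertrees $f$ of $G$. It is known that they do not depend on the order on $E$, and that $I_G$ does not depend on which of the two colour classes is taken as the set of hyperedges. *)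

theory Defs
  imports
    "Graph_Theory.Graph_Theory"
    "HOL-Computational_Algebra.Polynomial"
    "HOL-Library.FuncSet"
begin

text \<open>
  A finite simple graph is a \<^locale>\<open>pair_graph\<close>: a finite loop-free digraph in which every
  edge \<open>{u, v}\<close> is represented by the two arcs \<open>(u, v)\<close> and \<open>(v, u)\<close>. Hence the degree of a
  vertex is its \<^const>\<open>out_degree\<close>.

  Every edge yields the directed cycle \<open>u, v, u\<close> of length 2, which is not a cycle of the simple
  graph; cycles of a simple graph are the directed cycles with at least three arcs. For the same
  reason \<^const>\<open>forest\<close>, \<^const>\<open>tree\<close> and \<^const>\<open>spanning_tree\<close> from the library, which forbid
  every directed cycle, are not the undirected notions here.
\<close>

definition simple_cycle :: "'a pair_pre_digraph \<Rightarrow> ('a \<times> 'a) list \<Rightarrow> bool" where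
  "simple_cycle G p \<longleftrightarrow> pre_digraph.cycle (with_proj G) p \<and> 3 \<le> length p"

definition cycle_graph :: "'a pair_pre_digraph \<Rightarrow> nat \<Rightarrow> bool" where
  "cycle_graph G k \<longleftrightarrow> pair_graph G \<and>
     (\<exists>p. simple_cycle G p \<and> length p = k \<and>
          pverts G = fst ` set p \<and> parcs G = set p \<union> (set p)\<inverse>)"

definition simple_tree :: "'a pair_pre_digraph \<Rightarrow> bool" where
  "simple_tree T \<longleftrightarrow> pair_graph T \<and> connected (with_proj T) \<and> (\<nexists>p. simple_cycle T p)"

definition simple_spanning_tree :: "'a pair_pre_digraph \<Rightarrow> 'a pair_pre_digraph \<Rightarrow> bool" where
  "simple_spanning_tree T G \<longleftrightarrow> simple_tree T \<and> spanning (with_proj T) (with_proj G)"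

definition bipartite_graph :: "'a pair_pre_digraph \<Rightarrow> 'a set \<Rightarrow> 'a set \<Rightarrow> bool" where
  "bipartite_graph G V E \<longleftrightarrow> pair_graph G \<and> V \<noteq> {} \<and> E \<noteq> {} \<and> V \<inter> E = {} \<and>
     pverts G = V \<union> E \<and> parcs G \<subseteq> V \<times> E \<union> E \<times> V"

text \<open>
  Functions \<open>E \<rightarrow> {0, 1, 2, \<dots>}\<close> are represented by extensional functions, so that distinct HOL
  functions correspond to distinct functions on \<open>E\<close>.
\<close>

definition hypertree :: "'a pair_pre_digraph \<Rightarrow> 'a set \<Rightarrow> ('a \<Rightarrow> nat) \<Rightarrow> bool" where
  "hypertree G E f \<longleftrightarrow> f \<in> E \<rightarrow>\<^sub>E UNIV \<and>
     (\<exists>T. simple_spanning_tree T G \<and> (\<forall>e\<in>E. out_degree (with_proj T) e = f e + 1))"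

text \<open>The condition \<open>0 < f e\<close> keeps the subtraction on \<^typ>\<open>nat\<close> from truncating.\<close>

definition can_transfer ::
  "'a pair_pre_digraph \<Rightarrow> 'a set \<Rightarrow> ('a \<Rightarrow> nat) \<Rightarrow> 'a \<Rightarrow> 'a \<Rightarrow> bool" where
  "can_transfer G E f e e' \<longleftrightarrow> e \<in> E \<and> e' \<in> E \<and> e \<noteq> e' \<and> 0 < f e \<and>
     hypertree G E (f(e := f e - 1, e' := f e' + 1))"

text \<open>
  In the following, \<open>r\<close> is the total order on \<open>E\<close> in its reflexive form, as in
  \<^const>\<open>linear_order_on\<close>.
\<close>

definition internally_inactive ::
  "'a pair_pre_digraph \<Rightarrow> 'a set \<Rightarrow> 'a rel \<Rightarrow> ('a \<Rightarrow> nat) \<Rightarrow> 'a \<Rightarrow> bool" where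
  "internally_inactive G E r f e \<longleftrightarrow>
     (\<exists>e'\<in>E. (e', e) \<in> r \<and> e' \<noteq> e \<and> can_transfer G E f e e')"

definition externally_inactive ::
  "'a pair_pre_digraph \<Rightarrow> 'a set \<Rightarrow> 'a rel \<Rightarrow> ('a \<Rightarrow> nat) \<Rightarrow> 'a \<Rightarrow> bool" where
  "externally_inactive G E r f e \<longleftrightarrow>
     (\<exists>e'\<in>E. (e', e) \<in> r \<and> e' \<noteq> e \<and> can_transfer G E f e' e)"

definition interior_polynomial ::
  "'a pair_pre_digraph \<Rightarrow> 'a set \<Rightarrow> 'a rel \<Rightarrow> int poly" where
  "interior_polynomial G E r =
     (\<Sum>f | hypertree G E f. monom 1 (card {e \<in> E. internally_inactive G E r f e}))"

definition exterior_polynomial ::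
  "'a pair_pre_digraph \<Rightarrow> 'a set \<Rightarrow> 'a rel \<Rightarrow> int poly" where
  "exterior_polynomial G E r =
     (\<Sum>f | hypertree G E f. monom 1 (card {e \<in> E. externally_inactive G E r f e}))"

end

theory Submission
  imports
    Defs
    "HOL-Number_Theory.Cong"
begin

text \<open>
  The spanning trees of a cycle arise by deleting one edge, and each edge has exactly one end in
  \<open>E\<close>. So the hypertrees are the functions that are 0 at one hyperedge \<open>e\<close> and 1 elsewhere, and
  the only possible transfers are from some \<open>a \<noteq> e\<close> to \<open>e\<close>. Hence exactly the \<open>a\<close> above \<open>e\<close> are
  internally inactive, and only \<open>e\<close> can be externally inactive, which happens unless \<open>e\<close> is the
  least element. Since \<open>card E = n\<close>, summing over \<open>e\<close> gives both polynomials.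
\<close>

section \<open>Cyclic enumerations of a cycle\<close>

text \<open>Indexing by all naturals with period \<open>m\<close> turns rotation into a shift of the
  index and makes the closing arc an arc like any other.\<close>

definition cyclic_enum :: "nat \<Rightarrow> (nat \<Rightarrow> 'a) \<Rightarrow> 'a rel \<Rightarrow> bool" where
  "cyclic_enum m c S \<longleftrightarrow> 0 < m \<and> (\<forall>i j. c i = c j \<longleftrightarrow> i mod m = j mod m) \<and>
     S = range (\<lambda>i. (c i, c (Suc i)))"

lemma cyclic_enum_shift:
  assumes "cyclic_enum m c S"
  shows "cyclic_enum m (\<lambda>i. c (i + k)) S"
proof -
  have m: "0 < m" and c: "\<And>i j. c i = c j \<longleftrightarrow> i mod m = j mod m"
    and S: "S = range (\<lambda>i. (c i, c (Suc i)))"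
    using assms by (auto simp: cyclic_enum_def)
  have "(c i, c (Suc i)) \<in> range (\<lambda>i. (c (i + k), c (Suc i + k)))" for i
  proof (rule range_eqI)
    \<comment> \<open>The index \<open>i + (m - 1) * k\<close> stands in for \<open>i - k\<close>,
      which could truncate.\<close>
    have "(i + (m - 1) * k) + k = i + m * k"
      using m by (cases m) auto
    then show "(c i, c (Suc i)) =
        (c (i + (m - 1) * k + k), c (Suc (i + (m - 1) * k) + k))"
      by (simp only: c add_Suc prod.inject) (simp flip: add_Suc)
  qed
  moreover have "(i + k) mod m = (j + k) mod m \<longleftrightarrow> i mod m = j mod m" for i j
    using cong_add_rcancel_nat[of i k j m] by (simp add: cong_def)
  ultimately show ?thesis
    using m by (auto simp: cyclic_enum_def S c)
qed

text \<open>Rotation makes any given arc the wrap-around one, from index \<open>m - 1\<close> to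
  index 0, which is where the cycle will be cut open.\<close>

lemma cyclic_enum_end_at:
  assumes "cyclic_enum m c S" "(u, v) \<in> S"
  obtains c' where "cyclic_enum m c' S" "c' (m - 1) = u" "c' 0 = v"
proof -
  have m: "0 < m" and c: "\<And>i j. c i = c j \<longleftrightarrow> i mod m = j mod m"
    using assms(1) by (auto simp: cyclic_enum_def)
  obtain k where k: "u = c k" "v = c (Suc k)"
    using assms by (auto simp: cyclic_enum_def)
  have "m - 1 + Suc k = k + m" using m by simp
  then show thesis
    using that[OF cyclic_enum_shift[OF assms(1), of "Suc k"]] by (simp add: k c)
qed

text \<open>In a library cycle the heads \<open>map snd p\<close> of the arcs are distinct, so they
  serve as the enumeration when read modulo the length.\<close>

lemma cycle_cyclic_enum:
  assumes "pair_graph G" "pre_digraph.cycle (with_proj G) p"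
  obtains c where "cyclic_enum (length p) c (set p)"
proof -
  interpret pair_graph G by fact
  obtain u where u: "awalk u p u" "distinct (tl (pawalk_verts u p))" "p \<noteq> []"
    using assms(2) by (auto simp: cycle_def)
  have cas: "pcas u p u" using u(1) by (auto simp: awalk_def)
  define m where "m = length p"
  have m: "0 < m" using u(3) by (simp add: m_def)
  have v1: "pawalk_verts u p = fst (hd p) # map snd p"
    using awalk_verts_conv'[OF cas] u(3) by simp
  have v2: "pawalk_verts u p = map fst p @ [snd (last p)]"
    using awalk_verts_conv[of u p] u(3) by simp
  have ends: "fst (hd p) = snd (last p)"
    using awhd_if_cas[OF cas] awlast_if_cas[OF cas] using v1 v2 u(3) by (simp add: last_map)
  \<comment> \<open>Comparing the two forms of the vertex list at position \<open>Suc i\<close>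
    shows that consecutive arcs meet.\<close>
  have step: "fst (p ! Suc i) = snd (p ! i)" if "Suc i < m" for i
    using arg_cong[OF trans[OF v1[symmetric] v2], of "\<lambda>l. l ! Suc i"] that
    by (simp add: nth_append m_def)
  define c where "c i = snd (p ! (i mod m))" for i
  have c: "c i = c j \<longleftrightarrow> i mod m = j mod m" for i j
    using nth_eq_iff_index_eq[of "map snd p" "i mod m" "j mod m"] u(2) m
    by (simp add: v1 c_def m_def)
  \<comment> \<open>The index is off by one: \<open>c i\<close> is the head of arc
    \<open>i mod m\<close>, hence the tail of the next arc. The first case is the wrap-around,
    settled by \<open>ends\<close>.\<close>
  have arc: "p ! (Suc i mod m) = (c i, c (Suc i))" for i
  proof (cases "Suc (i mod m) = m")
    case True
    then have "Suc i mod m = 0" "i mod m = m - 1" by (auto simp: mod_Suc)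
    then show ?thesis
      using ends u(3) by (auto simp: c_def m_def hd_conv_nth last_conv_nth prod_eq_iff)
  next
    case False
    then have "Suc i mod m = Suc (i mod m)" "Suc (i mod m) < m"
      using m by (auto simp: mod_Suc intro: Suc_lessI)
    then show ?thesis using step[of "i mod m"] by (auto simp: c_def prod_eq_iff)
  qed
  have "set p = range (\<lambda>i. (c i, c (Suc i)))"
  proof (intro equalityI subsetI)
    fix a assume "a \<in> set p"
    then obtain j where "j < m" "a = p ! j" by (auto simp: in_set_conv_nth m_def)
    \<comment> \<open>\<open>j + m - 1\<close> is the predecessor of \<open>j\<close> modulo
      \<open>m\<close>, also for \<open>j = 0\<close>.\<close>
    then show "a \<in> range (\<lambda>i. (c i, c (Suc i)))"
      using arc[of "j + m - 1"] m by (auto intro!: range_eqI[of _ _ "j + m - 1"])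
  next
    fix a assume "a \<in> range (\<lambda>i. (c i, c (Suc i)))"
    then show "a \<in> set p" using m by (auto simp: arc[symmetric] m_def)
  qed
  then show thesis using that m c by (auto simp: cyclic_enum_def m_def)
qed

text \<open>Once \<open>v\<close> is rotated to index 1, its neighbours sit at 0 and 2, and these
  indices differ modulo \<open>m\<close> because \<open>m\<close> is at least 3.\<close>

lemma cyclic_enum_neighbours:
  assumes "cyclic_enum m c S" "3 \<le> m" "v \<in> fst ` S"
  obtains a b where "a \<noteq> b" "{x. (v, x) \<in> S \<union> S\<inverse>} = {a, b}" "{a, b} \<subseteq> fst ` S"
proof -
  obtain i where "v = c i" using assms(1,3) by (auto simp: cyclic_enum_def)
  then have "(v, c (Suc i)) \<in> S" using assms(1) by (auto simp: cyclic_enum_def)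
  then obtain c' where c': "cyclic_enum m c' S" "c' (m - 1) = v"
    using cyclic_enum_end_at[OF assms(1)] by metis
  obtain d where d: "cyclic_enum m d S" "d 1 = v"
  proof
    show "cyclic_enum m (\<lambda>i. c' (i + (m - 2))) S" using c'(1) by (rule cyclic_enum_shift)
    have "1 + (m - 2) = m - 1" using assms(2) by simp
    then show "c' (1 + (m - 2)) = v" using c'(2) by simp
  qed
  have inj: "\<And>i j. d i = d j \<longleftrightarrow> i mod m = j mod m"
    and S: "S = range (\<lambda>i. (d i, d (Suc i)))"
    using d by (auto simp: cyclic_enum_def)
  show thesis
  proof
    show "d 0 \<noteq> d 2" using assms(2) by (simp add: inj)
    have "d i = v \<Longrightarrow> d (Suc i) = d 2" for i
      using d(2) by (metis inj mod_Suc_eq numeral_2_eq_2 One_nat_def)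
    moreover have "d i = d 0" if "d (Suc i) = v" for i
      using that d(2)[symmetric] cong_add_rcancel_nat[of i 1 0 m] by (simp add: inj cong_def)
    ultimately have "\<And>x. (v, x) \<in> S \<Longrightarrow> x = d 2" "\<And>x. (x, v) \<in> S \<Longrightarrow> x = d 0"
      unfolding S by blast+
    moreover have "(v, d 2) \<in> S" "(d 0, v) \<in> S"
      using d(2) by (auto simp: S numeral_2_eq_2)
    ultimately show "{x. (v, x) \<in> S \<union> S\<inverse>} = {d 0, d 2}"
      by blast
    show "{d 0, d 2} \<subseteq> fst ` S" by (auto simp: S image_image)
  qed
qed

section \<open>Paths and trees\<close>

definition path_arcs :: "nat \<Rightarrow> (nat \<Rightarrow> 'a) \<Rightarrow> 'a rel" where
  "path_arcs m c = {(c i, c (Suc i)) |i. Suc i < m} \<union> {(c (Suc i), c i) |i. Suc i < m}"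

lemma cyclic_enum_delete_edge:
  assumes "cyclic_enum m c S" "3 \<le> m"
  shows "S \<union> S\<inverse> - {(c (m - 1), c 0), (c 0, c (m - 1))} = path_arcs m c"
    and "fst ` S = c ` {..<m}"
proof -
  have inj: "\<And>i j. c i = c j \<longleftrightarrow> i mod m = j mod m"
    and S: "S = range (\<lambda>i. (c i, c (Suc i)))"
    using assms by (auto simp: cyclic_enum_def)
  have red: "c i = c (i mod m)" for i by (simp add: inj)
  have S': "S = (\<lambda>i. (c i, c (Suc i))) ` {..<m}"
  proof -
    have "(c i, c (Suc i)) = (c (i mod m), c (Suc (i mod m)))" for i
      by (simp add: inj mod_Suc_eq)
    moreover have "i mod m < m" for i using assms(2) by simp
    ultimately show ?thesis unfolding S by blast
  qed
  show "fst ` S = c ` {..<m}" by (auto simp: S' image_image)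
  have "{..<m} = insert (m - 1) {i. Suc i < m}" using assms(2) by auto
  define A where "A = {(c i, c (Suc i)) |i. Suc i < m}"
  have "S = insert (c (m - 1), c 0) A"
    using assms(2) \<open>{..<m} = _\<close> by (auto simp: S' inj A_def)
  \<comment> \<open>The reverse closing arc could be an arc of \<open>A\<close> only for
    \<open>m = 2\<close>.\<close>
  moreover have "(c (m - 1), c 0) \<notin> A" "(c 0, c (m - 1)) \<notin> A"
    using assms(2) by (auto simp: inj A_def dest!: dvd_imp_le)
  moreover have "path_arcs m c = A \<union> A\<inverse>" by (auto simp: path_arcs_def A_def)
  ultimately show "S \<union> S\<inverse> - {(c (m - 1), c 0), (c 0, c (m - 1))} = path_arcs m c"
    by blast
qed

text \<open>The first vertex of a path in \<open>X\<close> has at most one neighbour in \<open>X\<close>.\<close>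

lemma path_avoids_min_degree_two:
  assumes "inj_on c {..<m}"
    and two: "\<And>x. x \<in> X \<Longrightarrow> \<exists>a\<in>X. \<exists>b\<in>X. a \<noteq> b \<and> (x, a) \<in> path_arcs m c \<and> (x, b) \<in> path_arcs m c"
    and "i < m"
  shows "c i \<notin> X"
  using \<open>i < m\<close>
proof (induction i)
  case 0
  have "a = c 1" if "(c 0, a) \<in> path_arcs m c" for a
    using that assms(1) by (auto simp: path_arcs_def inj_on_eq_iff)
  then show ?case using two by blast
next
  case (Suc i)
  have "a = c i \<or> a = c (Suc (Suc i))" if "(c (Suc i), a) \<in> path_arcs m c" for a
    using that assms(1) Suc.prems by (auto simp: path_arcs_def inj_on_eq_iff)
  then show ?case using two Suc by (metis Suc_lessD)
qed

text \<open>The library's \<open>connected\<close> passes to the symmetric closure; for a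
  \<open>pair_graph\<close> this changes nothing, so connectedness becomes plain
  reachability.\<close>

lemma mk_symmetric_pair_graph:
  assumes "pair_graph T"
  shows "mk_symmetric (with_proj T) = T"
proof -
  interpret pair_graph T by fact
  have "(\<Union>a\<in>parcs T. {(fst a, snd a), (snd a, fst a)}) = parcs T"
    using arcs_symmetric by auto
  then show ?thesis by (simp add: mk_symmetric_def)
qed

lemma connected_pair_graph_iff:
  assumes "pair_graph T"
  shows "connected (with_proj T) \<longleftrightarrow>
    pverts T \<noteq> {} \<and> (\<forall>u\<in>pverts T. \<forall>v\<in>pverts T. (u, v) \<in> rtrancl_on (pverts T) (parcs T))"
  unfolding connected_def mk_symmetric_pair_graph[OF assms] strongly_connected_def reachable_def
  by simp

text \<open>Every vertex is reachable from \<open>c 0\<close>, and by symmetry the walks can be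
  reversed. Each vertex of a cycle would have two neighbours on that cycle, which
  \<open>path_avoids_min_degree_two\<close> excludes on a path.\<close>

lemma path_simple_tree:
  assumes "pair_graph T" "inj_on c {..<m}" "0 < m"
    and "pverts T = c ` {..<m}" "parcs T = path_arcs m c"
  shows "simple_tree T"
proof -
  interpret pair_graph T by fact
  have from0: "c 0 \<rightarrow>\<^sup>*\<^bsub>T\<^esub> c i" if "i < m" for i
    using that
  proof (induction i)
    case 0
    then show ?case using assms(4) by (intro reachable_refl) auto
  next
    case (Suc i)
    then have "(c i, c (Suc i)) \<in> parcs T" by (auto simp: assms(5) path_arcs_def)
    then show ?case using Suc by (auto intro: reachable_adj_trans)
  qed
  have "u \<rightarrow>\<^sup>*\<^bsub>T\<^esub> v" if "u \<in> pverts T" "v \<in> pverts T" for u v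
    using that from0 unfolding assms(4)
    by (metis (no_types, lifting) imageE lessThan_iff reachable_trans symmetric_reachable[OF sym_arcs])
  then have "connected (with_proj T)"
    unfolding connected_pair_graph_iff[OF assms(1)] using assms(3,4)
    by (auto simp: reachable_def)
  moreover have False if "simple_cycle T q" for q
  proof -
    have q: "cycle q" "3 \<le> length q" using that by (auto simp: simple_cycle_def)
    then obtain d where d: "cyclic_enum (length q) d (set q)"
      using cycle_cyclic_enum[OF assms(1)] by blast
    have sub: "set q \<union> (set q)\<inverse> \<subseteq> path_arcs m c"
      using q(1) arcs_symmetric by (auto simp: cycle_def awalk_def assms(5)[symmetric])
    have avoid: "c i \<notin> fst ` set q" if "i < m" for i
    proof (rule path_avoids_min_degree_two[OF assms(2) _ that])
      fix x assume "x \<in> fst ` set q"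
      then obtain a b where ab: "a \<noteq> b" "{y. (x, y) \<in> set q \<union> (set q)\<inverse>} = {a, b}"
        "{a, b} \<subseteq> fst ` set q"
        using cyclic_enum_neighbours[OF d q(2)] by metis
      have "(x, y) \<in> path_arcs m c" if "y \<in> {a, b}" for y
        using that sub unfolding ab(2)[symmetric] by blast
      then show "\<exists>a\<in>fst ` set q. \<exists>b\<in>fst ` set q. a \<noteq> b \<and>
          (x, a) \<in> path_arcs m c \<and> (x, b) \<in> path_arcs m c"
        using ab(1,3) by (intro bexI[of _ a] bexI[of _ b] conjI) auto
    qed
    obtain x where x: "x \<in> fst ` set q" using q(2) by (cases q) auto
    moreover have "fst ` set q \<subseteq> c ` {..<m}"
      using q(1) unfolding assms(4)[symmetric] cycle_def awalk_def by (blast dest: arc_fst_in_verts)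
    ultimately have "x \<in> c ` {..<m}" by (rule rev_subsetD)
    then show False using avoid x by fastforce
  qed
  ultimately show ?thesis using assms(1) by (auto simp: simple_tree_def)
qed

text \<open>A proper initial segment of a path is left only through the arc that follows it.\<close>

lemma connected_subgraph_of_path:
  assumes "pair_graph T" "connected (with_proj T)" "inj_on c {..<m}"
    and "pverts T = c ` {..<m}" "parcs T \<subseteq> path_arcs m c"
  shows "parcs T = path_arcs m c"
proof -
  interpret pair_graph T by fact
  have "(c i, c (Suc i)) \<in> parcs T" if i: "Suc i < m" for i
  proof (rule ccontr)
    assume no: "(c i, c (Suc i)) \<notin> parcs T"
    have "(c 0, c (Suc i)) \<in> rtrancl_on (pverts T) (parcs T)"
      using assms(2,4) i unfolding connected_pair_graph_iff[OF assms(1)] by auto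
    then have "c (Suc i) \<in> c ` {..i}"
    proof (induction rule: rtrancl_on_induct)
      case (step x y)
      then obtain j where j: "j \<le> i" "x = c j" by auto
      from step have "(c j, y) \<in> path_arcs m c" using j assms(5) by auto
      then have "y = c (Suc j) \<or> (\<exists>k<j. y = c k)"
        using j i assms(3) by (auto simp: path_arcs_def inj_on_eq_iff)
      moreover have "j \<noteq> i" if "y = c (Suc j)"
        using that step no j by auto
      ultimately show ?case using j by (force simp: le_less)
    qed auto
    then show False using i assms(3) by (auto simp: inj_on_eq_iff)
  qed
  then show ?thesis
    using assms(5) arcs_symmetric by (auto simp: path_arcs_def)
qed

section \<open>Spanning trees of a cycle\<close>

text \<open>A spanning tree misses some edge of the cycle, since otherwise it would contain
  \<open>p\<close>. Being connected, it is then the whole path that is left. Conversely, every such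
  path is a tree.\<close>

lemma spanning_tree_cycle_graph_iff:
  assumes "cycle_graph G m"
  shows "simple_spanning_tree T G \<longleftrightarrow>
    (\<exists>(u, v)\<in>parcs G. T = G\<lparr>parcs := parcs G - {(u, v), (v, u)}\<rparr>)"
proof -
  obtain p where G: "pair_graph G" and p: "simple_cycle G p" "length p = m"
    and verts: "pverts G = fst ` set p" and arcs: "parcs G = set p \<union> (set p)\<inverse>"
    using assms by (auto simp: cycle_graph_def)
  interpret pair_graph G by fact
  have m: "3 \<le> m" and cyc: "cycle p" using p by (auto simp: simple_cycle_def)
  obtain c0 where c0: "cyclic_enum m c0 (set p)"
    using cycle_cyclic_enum[OF G cyc] p by auto
  have path: "\<exists>c. inj_on c {..<m} \<and> pverts G = c ` {..<m} \<and>
      parcs G - {(u, v), (v, u)} = path_arcs m c" if uv: "(u, v) \<in> set p" for u v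
  proof -
    obtain c where c: "cyclic_enum m c (set p)" "c (m - 1) = u" "c 0 = v"
      using cyclic_enum_end_at[OF c0 uv] by blast
    have "inj_on c {..<m}" using c by (auto simp: cyclic_enum_def inj_on_def)
    then show ?thesis
      using cyclic_enum_delete_edge[OF c(1) m] c(2,3) verts arcs by auto
  qed
  show ?thesis
  proof
    assume "simple_spanning_tree T G"
    then have T: "pair_graph T" "connected (with_proj T)" "\<nexists>q. simple_cycle T q"
      "pverts T = pverts G" "parcs T \<subseteq> parcs G"
      by (auto simp: simple_spanning_tree_def simple_tree_def spanning_def subgraph_def)
    interpret T: pair_graph T by fact
    have "\<not> set p \<subseteq> parcs T"
    proof
      assume "set p \<subseteq> parcs T"
      then have "T.cycle p" using cyc T(4)
        by (auto simp: cycle_def T.cycle_def awalk_def T.awalk_def)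
      then show False using T(3) p m by (auto simp: simple_cycle_def)
    qed
    then obtain u v where uv: "(u, v) \<in> set p" "(u, v) \<notin> parcs T" by auto
    then have "parcs T \<subseteq> parcs G - {(u, v), (v, u)}"
      using T(5) T.arcs_symmetric by blast
    moreover obtain c where "inj_on c {..<m}" "pverts G = c ` {..<m}"
      "parcs G - {(u, v), (v, u)} = path_arcs m c" using path[OF uv(1)] by auto
    ultimately have "parcs T = parcs G - {(u, v), (v, u)}"
      using connected_subgraph_of_path[OF T(1,2)] T(4) by metis
    then have "T = G\<lparr>parcs := parcs G - {(u, v), (v, u)}\<rparr>" using T(4) by simp
    then show "\<exists>(u, v)\<in>parcs G. T = G\<lparr>parcs := parcs G - {(u, v), (v, u)}\<rparr>"
      using uv arcs by auto
  next
    assume "\<exists>(u, v)\<in>parcs G. T = G\<lparr>parcs := parcs G - {(u, v), (v, u)}\<rparr>"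
    \<comment> \<open>Both orientations name the same deleted edge, so \<open>(u, v)\<close> may be
      taken along \<open>p\<close>.\<close>
    then obtain u v where uv: "(u, v) \<in> set p"
      and T: "T = G\<lparr>parcs := parcs G - {(u, v), (v, u)}\<rparr>"
      unfolding arcs by (auto simp: insert_commute)
    have pg: "pair_graph T"
    proof
      show "symmetric (with_proj T)"
        using arcs_symmetric by (auto simp: T symmetric_def intro!: symI)
    qed (auto simp: T pair_finite_verts pair_finite_arcs intro: in_arcsD1 in_arcsD2 dest: no_loops')
    obtain c where "inj_on c {..<m}" "pverts G = c ` {..<m}"
      "parcs G - {(u, v), (v, u)} = path_arcs m c" using path[OF uv(1)] by auto
    then have "simple_tree T"
      using m by (intro path_simple_tree[OF pg, of c m]) (auto simp: T)
    moreover have "wf_digraph (with_proj T)" "wf_digraph (with_proj G)"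
      using pg G pair_graph.axioms(1) pair_digraph.pair_wf_digraph wf_digraph_wp_iff by metis+
    then have "spanning (with_proj T) (with_proj G)"
      by (auto simp: spanning_def subgraph_def compatible_def T)
    ultimately show "simple_spanning_tree T G" by (simp add: simple_spanning_tree_def)
  qed
qed

section \<open>Degrees and sizes of the colour classes\<close>

lemma out_degree_with_proj: "out_degree (with_proj G) v = card {x. (v, x) \<in> parcs G}"
proof -
  have "out_arcs (with_proj G) v = Pair v ` {x. (v, x) \<in> parcs G}"
    by (auto simp: out_arcs_def)
  then show ?thesis by (simp add: out_degree_def card_image inj_on_def)
qed

lemma cycle_graph_degree:
  assumes "cycle_graph G m" "v \<in> pverts G"
  shows "card {x. (v, x) \<in> parcs G} = 2"
proof -
  obtain p where G: "pair_graph G" and p: "simple_cycle G p"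
    and verts: "pverts G = fst ` set p" and arcs: "parcs G = set p \<union> (set p)\<inverse>"
    using assms by (auto simp: cycle_graph_def)
  obtain c where "cyclic_enum (length p) c (set p)"
    using cycle_cyclic_enum[OF G] p by (auto simp: simple_cycle_def)
  then obtain a b where "a \<noteq> b" "{x. (v, x) \<in> set p \<union> (set p)\<inverse>} = {a, b}"
    using cyclic_enum_neighbours[of "length p" c "set p" v] p assms(2) verts
    unfolding simple_cycle_def by metis
  then show ?thesis by (simp add: arcs)
qed

lemma cycle_graph_card_verts:
  assumes "cycle_graph G m"
  shows "card (pverts G) = m"
proof -
  obtain p where G: "pair_graph G" and p: "simple_cycle G p" "length p = m"
    and verts: "pverts G = fst ` set p"
    using assms by (auto simp: cycle_graph_def)
  obtain c where c: "cyclic_enum m c (set p)"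
    using cycle_cyclic_enum[OF G] p by (auto simp: simple_cycle_def)
  then have "inj_on c {..<m}" by (auto simp: cyclic_enum_def inj_on_def)
  then show ?thesis
    using cyclic_enum_delete_edge(2)[OF c] p by (simp add: verts card_image simple_cycle_def)
qed

text \<open>Double counting: reversal matches the \<open>d * card V\<close> arcs leaving
  \<open>V\<close> with the \<open>d * card E\<close> arcs leaving \<open>E\<close>.\<close>

lemma regular_bipartite_card_eq:
  assumes "bipartite_graph G V E" "0 < d"
    and deg: "\<And>v. v \<in> pverts G \<Longrightarrow> card {x. (v, x) \<in> parcs G} = d"
  shows "card V = card E"
proof -
  interpret pair_graph G using assms by (simp add: bipartite_graph_def)
  have b: "pverts G = V \<union> E" "V \<inter> E = {}" "parcs G \<subseteq> V \<times> E \<union> E \<times> V"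
    using assms by (auto simp: bipartite_graph_def)
  have fin: "finite {x. (v, x) \<in> parcs G}" for v
    using finite_imageI[OF pair_finite_arcs, of snd] by (rule rev_finite_subset) force
  have cnt: "card (parcs G \<inter> A \<times> UNIV) = d * card A" if "A \<subseteq> pverts G" for A
  proof -
    have "parcs G \<inter> A \<times> UNIV = (SIGMA v:A. {x. (v, x) \<in> parcs G})" by auto
    moreover have "finite A" using that pair_finite_verts by (rule finite_subset)
    moreover have "(\<Sum>v\<in>A. card {x. (v, x) \<in> parcs G}) = (\<Sum>v\<in>A. d)"
      using that deg by (intro sum.cong) auto
    ultimately show ?thesis using fin by (simp add: mult.commute)
  qed
  have "parcs G \<inter> E \<times> UNIV = prod.swap ` (parcs G \<inter> V \<times> UNIV)"
  proof (intro equalityI subsetI)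
    fix x assume x: "x \<in> parcs G \<inter> E \<times> UNIV"
    then have "prod.swap x \<in> parcs G \<inter> V \<times> UNIV"
      using b arcs_symmetric by (cases x) auto
    then show "x \<in> prod.swap ` (parcs G \<inter> V \<times> UNIV)"
      by (metis image_eqI swap_swap)
  qed (use b arcs_symmetric in auto)
  then have "card (parcs G \<inter> E \<times> UNIV) = card (parcs G \<inter> V \<times> UNIV)"
    by (simp add: card_image)
  then show ?thesis using cnt[of E] cnt[of V] b(1) assms(2) by simp
qed

section \<open>Hypertrees of a cycle\<close>

lemma hypertree_cycle_graph_iff:
  assumes bip: "bipartite_graph G V E" and cyc: "cycle_graph G m"
  shows "hypertree G E f \<longleftrightarrow> (\<exists>e\<in>E. f = (\<lambda>x\<in>E. if x = e then 0 else 1))"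
proof -
  interpret pair_graph G using assms by (simp add: bipartite_graph_def)
  have b: "pverts G = V \<union> E" "V \<inter> E = {}" "parcs G \<subseteq> V \<times> E \<union> E \<times> V"
    using bip by (auto simp: bipartite_graph_def)
  have deg: "card {x. (v, x) \<in> parcs G} = 2" if "v \<in> pverts G" for v
    using cycle_graph_degree[OF cyc that] .
  define del where "del u v = G\<lparr>parcs := parcs G - {(u, v), (v, u)}\<rparr>" for u v
  \<comment> \<open>The end \<open>v\<close> lies outside \<open>E\<close>, so among the degrees in
    \<open>E\<close> only that of \<open>e\<close> drops, from 2 to 1.\<close>
  have deg': "out_degree (with_proj (del e v)) x = (if x = e then 0 else 1) + 1"
    if "e \<in> E" "(e, v) \<in> parcs G" "x \<in> E" for e v x
  proof -
    have "v \<notin> E" using that b by auto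
    then have "{y. (x, y) \<in> parcs (del e v)} =
        {y. (x, y) \<in> parcs G} - (if x = e then {v} else {})"
      using that by (auto simp: del_def)
    then show ?thesis using deg[of x] that b(1) by (auto simp: out_degree_with_proj)
  qed
  \<comment> \<open>As \<open>del\<close> is symmetric in its arguments, the end in \<open>E\<close>
    can be written first.\<close>
  have span: "simple_spanning_tree T G \<longleftrightarrow> (\<exists>e\<in>E. \<exists>v. (e, v) \<in> parcs G \<and> T = del e v)" for T
  proof -
    have "simple_spanning_tree T G \<longleftrightarrow> (\<exists>u v. (u, v) \<in> parcs G \<and> T = del u v)"
      using spanning_tree_cycle_graph_iff[OF cyc] by (auto simp: del_def)
    moreover have "del u v = del v u" for u v by (simp add: del_def insert_commute)
    ultimately show ?thesis using b(3) arcs_symmetric by (metis (no_types) SigmaD1 UnE subsetD SigmaD2)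
  qed
  show ?thesis
  proof
    assume "hypertree G E f"
    then obtain T where f: "f \<in> E \<rightarrow>\<^sub>E UNIV" and T: "simple_spanning_tree T G"
      and d: "\<And>e. e \<in> E \<Longrightarrow> out_degree (with_proj T) e = f e + 1"
      by (auto simp: hypertree_def)
    obtain e v where e: "e \<in> E" "(e, v) \<in> parcs G" "T = del e v" using T span by auto
    \<comment> \<open>Outside \<open>E\<close> both sides are \<open>undefined\<close>, by
      extensionality.\<close>
    have "f x = (\<lambda>x\<in>E. if x = e then 0 else 1) x" for x
      using d[of x] deg'[OF e(1,2), of x] f e(3) by (cases "x \<in> E") auto
    then show "\<exists>e\<in>E. f = (\<lambda>x\<in>E. if x = e then 0 else 1)" using e(1) by blast
  next
    assume "\<exists>e\<in>E. f = (\<lambda>x\<in>E. if x = e then 0 else 1)"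
    then obtain e where e: "e \<in> E" and f: "f = (\<lambda>x\<in>E. if x = e then 0 else 1)" by auto
    \<comment> \<open>Either edge at \<open>e\<close> yields the same function, so any neighbour of
      \<open>e\<close> will do.\<close>
    have "{x. (e, x) \<in> parcs G} \<noteq> {}" using deg[of e] e b(1) by force
    then obtain v where v: "(e, v) \<in> parcs G" by auto
    then have "simple_spanning_tree (del e v) G" using span e by auto
    moreover have "\<forall>x\<in>E. out_degree (with_proj (del e v)) x = f x + 1"
      using deg'[OF e v] by (simp add: f)
    ultimately show "hypertree G E f" unfolding hypertree_def by (auto simp: f)
  qed
qed

section \<open>Ranks and the two polynomials\<close>

text \<open>Going up in the order strictly shrinks the set of larger elements, so the count is
  injective. It stays below \<open>card E\<close> because \<open>e\<close> itself is not counted,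
  and equal cardinalities then give surjectivity.\<close>

lemma bij_betw_rank:
  assumes "linear_order_on E r" "finite E"
  shows "bij_betw (\<lambda>e. card {a \<in> E. (e, a) \<in> r \<and> a \<noteq> e}) E {..<card E}"
proof -
  define up where "up e = {a \<in> E. (e, a) \<in> r \<and> a \<noteq> e}" for e
  have r: "trans r" "antisym r" "total_on E r"
    using assms by (auto simp: order_on_defs)
  have less: "card (up b) < card (up a)" if "(a, b) \<in> r" "a \<noteq> b" "b \<in> E" for a b
  proof (rule psubset_card_mono)
    show "finite (up a)" using assms(2) by (simp add: up_def)
    have "b \<in> up a" "b \<notin> up b" using that by (auto simp: up_def)
    moreover have "up b \<subseteq> up a"
      using that r by (auto simp: up_def dest: transD antisymD)
    ultimately show "up b \<subset> up a" by blast
  qed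
  have inj: "inj_on (\<lambda>e. card (up e)) E"
    using less r(3) by (intro inj_onI) (metis less_irrefl total_on_def)
  have "card (up e) < card E" if "e \<in> E" for e
    using assms(2) that by (intro psubset_card_mono) (auto simp: up_def)
  then have "(\<lambda>e. card (up e)) ` E = {..<card E}"
    using inj by (intro card_subset_eq) (auto simp: card_image)
  then show ?thesis using inj by (simp add: bij_betw_def up_def)
qed

theorem theorem47:
  fixes G :: "'a pair_pre_digraph" and V E :: "'a set" and r :: "'a rel" and n :: nat
  assumes "bipartite_graph G V E"
    and "linear_order_on E r"
    and "2 \<le> n"
    and "cycle_graph G (2 * n)"
  shows "interior_polynomial G E r = (\<Sum>k<n. monom 1 k)
       \<and> exterior_polynomial G E r = [:1, int n - 1:]"
proof -
  interpret pair_graph G using assms by (simp add: bipartite_graph_def)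
  have b: "pverts G = V \<union> E" "V \<inter> E = {}"
    using assms(1) by (auto simp: bipartite_graph_def)
  have fin: "finite V" "finite E" using pair_finite_verts b by auto
  have "card V + card E = 2 * n"
    using cycle_graph_card_verts[OF assms(4)] b fin by (simp add: card_Un_disjoint)
  moreover have "card V = card E"
    using regular_bipartite_card_eq[OF assms(1), of 2] cycle_graph_degree[OF assms(4)] by simp
  ultimately have card: "card E = n" by simp

  define h where "h e = (\<lambda>x\<in>E. if x = e then 0 else 1 :: nat)" for e
  have hyper: "hypertree G E f \<longleftrightarrow> f \<in> h ` E" for f
    using hypertree_cycle_graph_iff[OF assms(1,4)] by (auto simp: h_def)
  have h_eq: "h e x = (if x \<in> E then if x = e then 0 else 1 else undefined)" for e x
    by (simp add: h_def)
  have inj: "inj_on h E"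
    by (intro inj_onI) (metis h_eq zero_neq_one)
  have transfer: "can_transfer G E (h e) a a' \<longleftrightarrow> a \<in> E \<and> a' = e \<and> a \<noteq> e" if e: "e \<in> E" for e a a'
  proof
    assume l: "can_transfer G E (h e) a a'"
    then have a: "a \<in> E" "a' \<in> E" "a \<noteq> a'" "a \<noteq> e" by (auto simp: can_transfer_def h_eq)
    from l obtain e' where "(h e)(a := h e a - 1, a' := h e a' + 1) = h e'"
      by (auto simp: can_transfer_def hyper)
    \<comment> \<open>The new value \<open>h e a' + 1\<close> is a value of \<open>h e'\<close>,
      hence at most 1, so \<open>a'\<close> is the zero of \<open>h e\<close>.\<close>
    from fun_cong[OF this, of a'] have "a' = e" using a by (auto simp: h_eq split: if_splits)
    then show "a \<in> E \<and> a' = e \<and> a \<noteq> e" using a by simp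
  next
    assume a: "a \<in> E \<and> a' = e \<and> a \<noteq> e"
    \<comment> \<open>The transfer moves the zero from \<open>e\<close> to \<open>a\<close>.\<close>
    then have "(h e)(a := h e a - 1, a' := h e a' + 1) = h a"
      using e by (auto simp: h_eq fun_eq_iff)
    then show "can_transfer G E (h e) a a'" using a e by (auto simp: can_transfer_def hyper h_eq)
  qed
  have sum_h: "(\<Sum>f | hypertree G E f. F f) = (\<Sum>e\<in>E. F (h e))" for F :: "('a \<Rightarrow> nat) \<Rightarrow> int poly"
    using sum.reindex[OF inj, of F] by (simp add: hyper)

  have "{a \<in> E. internally_inactive G E r (h e) a} = {a \<in> E. (e, a) \<in> r \<and> a \<noteq> e}" if "e \<in> E" for e
    using that by (auto simp: internally_inactive_def transfer)
  then have "interior_polynomial G E r =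
      (\<Sum>e\<in>E. monom 1 (card {a \<in> E. (e, a) \<in> r \<and> a \<noteq> e}))"
    unfolding interior_polynomial_def sum_h by (intro sum.cong) simp_all
  also have "\<dots> = (\<Sum>k<n. monom 1 k)"
    using sum.reindex_bij_betw[OF bij_betw_rank[OF assms(2) fin(2)]] by (simp add: card)
  finally have interior: "interior_polynomial G E r = (\<Sum>k<n. monom 1 k)" .

  \<comment> \<open>This is the rank for the reversed order, counting the elements below
    \<open>e\<close>. Only the receiver \<open>e\<close> can be externally inactive, and it is so
    exactly when something lies below it.\<close>
  define low where "low e = card {a \<in> E. (e, a) \<in> r\<inverse> \<and> a \<noteq> e}" for e
  have "card {a \<in> E. externally_inactive G E r (h e) a} = (if low e = 0 then 0 else 1)"
    if "e \<in> E" for e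
  proof -
    have "{a \<in> E. externally_inactive G E r (h e) a} = (if low e = 0 then {} else {e})"
      using that fin by (auto simp: externally_inactive_def transfer low_def)
    then show ?thesis by simp
  qed
  then have "exterior_polynomial G E r = (\<Sum>e\<in>E. monom 1 (if low e = 0 then 0 else 1))"
    unfolding exterior_polynomial_def sum_h by (intro sum.cong) simp_all
  also have "\<dots> = (\<Sum>k<n. monom 1 (if k = 0 then 0 else 1))"
    using sum.reindex_bij_betw[OF bij_betw_rank[of E "r\<inverse>"], of "\<lambda>k. monom 1 (if k = 0 then 0 else 1)"]
      assms(2) fin by (simp add: card low_def)
  also have "\<dots> = [:1, int n - 1:]"
  proof -
    \<comment> \<open>Splitting off index 0 gives the constant 1; each of the other
      \<open>n - 1\<close> indices contributes the variable once.\<close>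
    obtain k where "n = Suc k" using assms(3) by (cases n) auto
    then show ?thesis
      by (simp add: sum.lessThan_Suc_shift monom_0 monom_Suc of_nat_poly del: sum.lessThan_Suc)
  qed
  finally show ?thesis using interior by simp
qed

end
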